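(* Let $X_t$ be a Lévy process on $\mathbb{R}$ with characteristics $(A,\gamma,\nu)$ and generator $L$ as described in the context. Suppose the function $\nu$ is monotonically increasing on each of the half-axes $(-\infty,0)$ and $(0,\infty)$, has a derivative $\nu'(x)$ for $x\neq 0$, and $$\int_{-\infty}^{\infty}\frac{x^{2}}{1+x^{2}}\,d\nu(x)=\int_{-\infty}^{\infty}\frac{x^{2}}{1+x^{2}}\,\nu'(x)\,dx<\infty,\qquad \nu(x)\to 0\ \text{ as } x\to\pm\infty .$$ Suppose in addition that at least one of the following two sets of conditions holds. (I) For every $0<M<\infty$, $\int_{-M}^{M}|\nu(x)|\,dx<\infty$ and $\int_{-M}^{M}|x|\,\nu'(x)\,dx<\infty$; and $x\nu(x)\to0$ as $x\to0$. (II) There is a function $k_1$ on $\mathbb{R}\setminus\{0\}$ with $k_1'(x)=\nu(x)$ for $x\ne0$ such that for every $0<M<\infty$, $\int_{-M}^{M}|k_1(x)|\,dx<\infty$ and $\int_{-M}^{M}|x\,\nu(x)|\,dx<\infty$; and $x\,k_1(x)\to0$, $x^{2}\nu(x)\to0$ as $x\to0$. Then $L$ has a convolution type form: there is a real function $k$ with $\int_{-M}^{M}|k(t)|\,dt<\infty$ for every $0<M<\infty$ such that $$Lf=\frac{d}{dx}\,S\,\frac{d}{dx}f,\qquad Sf=\frac12 A f+\int_{-\infty}^{\infty}k(y-x)f(y)\,dy,$$ for all compactly supported $f\in C_0^2$.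
   Context: $C_0$ is the Banach space of continuous functions on $\mathbb{R}$ tending to $0$ at $\pm\infty$ (sup norm); $C_0^{2}$ is the set of $f\in C_0$ with $f',f''\in C_0$. A Lévy process $X_t$ with $P(X_0=0)=1$ has characteristic function $E\{\exp[izX_t]\}=\exp[-t\lambda(z)]$, $t\ge0$, where $$\lambda(z)=\tfrac12Az^{2}-i\gamma z-\int_{-\infty}^{\infty}\bigl(e^{ixz}-1-ixz\,1_{D}(x)\bigr)\,d\nu(x),\qquad D=[-1,1],$$ $A\ge0$, $\gamma\in\mathbb{R}$, and $d\nu$ is the Lévy measure (no mass at $0$), with $\int \frac{x^2}{1+x^2}\,d\nu(x)<\infty$. Its generator $L$ acts on $f\in C_0^2$ by $$Lf=\tfrac12A f''+\gamma f'+\int_{-\infty}^{\infty}\bigl(f(x+y)-f(x)-y f'(x)1_{D}(y)\bigr)\,d\nu(y).$$ *)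

theory Defs
  imports "HOL-Probability.Probability"
begin

(* Cadlag paths are not required; every process that also has them is covered. *)
locale levy_process = prob_space M for M :: "'a measure" +
  fixes X :: "real \<Rightarrow> 'a \<Rightarrow> real"
  assumes measurable_X: "\<And>t. 0 \<le> t \<Longrightarrow> X t \<in> borel_measurable M"
    and start_0: "AE \<omega> in M. X 0 \<omega> = 0"
    and indep_increments:
      "\<And>(t :: nat \<Rightarrow> real) n. \<lbrakk>0 \<le> t 0; strict_mono_on {..n} t\<rbrakk> \<Longrightarrow>
         indep_vars (\<lambda>_. borel) (\<lambda>j \<omega>. X (t (Suc j)) \<omega> - X (t j) \<omega>) {..<n}"
    and stationary_increments:
      "\<And>s t. \<lbrakk>0 \<le> s; 0 \<le> t\<rbrakk> \<Longrightarrow>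
         distr M borel (\<lambda>\<omega>. X (s + t) \<omega> - X s \<omega>) = distr M borel (X t)"
    and stochastically_continuous:
      "\<And>t \<epsilon>. \<lbrakk>0 \<le> t; 0 < \<epsilon>\<rbrakk> \<Longrightarrow>
         ((\<lambda>s. prob {\<omega> \<in> space M. \<bar>X s \<omega> - X t \<omega>\<bar> > \<epsilon>}) \<longlongrightarrow> 0) (at t within {0..})"

definition levy_measure :: "real measure \<Rightarrow> bool" where
  "levy_measure N \<longleftrightarrow> sets N = sets borel \<and> emeasure N {0} = 0 \<and>
     (\<integral>\<^sup>+x. ennreal (x\<^sup>2 / (1 + x\<^sup>2)) \<partial>N) < \<infinity>"

definition levy_exponent :: "real \<Rightarrow> real \<Rightarrow> real measure \<Rightarrow> real \<Rightarrow> complex" where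
  "levy_exponent A \<gamma> N z =
     complex_of_real (A * z\<^sup>2 / 2) - \<i> * complex_of_real (\<gamma> * z)
     - (CLINT x|N. exp (\<i> * complex_of_real (x * z)) - 1
          - \<i> * complex_of_real (x * z * indicator {-1..1} x))"

definition has_characteristics ::
    "'a measure \<Rightarrow> (real \<Rightarrow> 'a \<Rightarrow> real) \<Rightarrow> real \<Rightarrow> real \<Rightarrow> real measure \<Rightarrow> bool" where
  "has_characteristics M X A \<gamma> N \<longleftrightarrow> 0 \<le> A \<and> levy_measure N \<and>
     (\<forall>t\<ge>0. \<forall>z. char (distr M borel (X t)) z = exp (- (complex_of_real t * levy_exponent A \<gamma> N z)))"

definition C0 :: "(real \<Rightarrow> real) set" where
  "C0 = {f. continuous_on UNIV f \<and> (f \<longlongrightarrow> 0) at_top \<and> (f \<longlongrightarrow> 0) at_bot}"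

definition C0_2 :: "(real \<Rightarrow> real) set" where
  "C0_2 = {f \<in> C0. (\<forall>x. f differentiable at x) \<and> deriv f \<in> C0 \<and>
             (\<forall>x. deriv f differentiable at x) \<and> deriv (deriv f) \<in> C0}"

definition compactly_supported :: "(real \<Rightarrow> real) \<Rightarrow> bool" where
  "compactly_supported f \<longleftrightarrow> compact (closure {x. f x \<noteq> 0})"

(* The action on C0_2 of the generator of the Levy process with characteristics (A, \<gamma>, N);
   outside C0_2 the value carries no meaning. *)
definition levy_generator ::
    "real \<Rightarrow> real \<Rightarrow> real measure \<Rightarrow> (real \<Rightarrow> real) \<Rightarrow> real \<Rightarrow> real" where
  "levy_generator A \<gamma> N f x =
     A / 2 * deriv (deriv f) x + \<gamma> * deriv f x
     + (LINT y|N. f (x + y) - f x - y * deriv f x * indicator {-1..1} y)"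

(* The measure written d\<nu> for a function \<nu> on the two half-axes. No interval around 0 is
   constrained: \<nu> may be unbounded there, and levy_measure separately excludes mass at 0. *)
definition stieltjes_off_0 :: "(real \<Rightarrow> real) \<Rightarrow> real measure \<Rightarrow> bool" where
  "stieltjes_off_0 \<nu> N \<longleftrightarrow>
     (\<forall>a b. a \<le> b \<and> (b < 0 \<or> 0 < a) \<longrightarrow> emeasure N {a<..b} = ennreal (\<nu> b - \<nu> a))"

definition convolution_operator ::
    "real \<Rightarrow> (real \<Rightarrow> real) \<Rightarrow> (real \<Rightarrow> real) \<Rightarrow> real \<Rightarrow> real" where
  "convolution_operator A k g x = A / 2 * g x + (LINT y|lborel. k (y - x) * g y)"

end

theory Submission imports Defs begin

text \<open>
  Taylor's formula with integral remainder, together with $f'(x) = -\int_0^\infty f''(x+r)\,dr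
  = \int_{-\infty}^0 f''(x+r)\,dr$ for compactly supported $f$, writes the compensated increment
  $f(x+y) - f(x) - y f'(x) 1_D(y)$ as $\int \kappa(y,r) f''(x+r)\,dr$. Integrating against
  $d\nu(y)$ and applying Fubini gives $Lf = \frac12 A f'' + \int k(r) f''(x+r)\,dr$, where
  $k(r) = \gamma 1_{r<0} + \int \kappa(y,r)\,d\nu(y)$ is locally integrable because
  $\int_{-R}^R |\kappa(y,r)|\,dr$ is at most a multiple of $y^2/(1+y^2)$. One of the two
  derivatives is then pulled out of the integral.
\<close>

section \<open>Derivatives of compactly supported functions\<close>

lemma deriv_eq_0_outside:
  fixes f :: "real \<Rightarrow> real"
  assumes "\<And>x. B < \<bar>x\<bar> \<Longrightarrow> f x = 0" and "B < \<bar>x\<bar>"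
  shows "deriv f x = 0"
proof -
  have "open {x :: real. B < \<bar>x\<bar>}"
    by (intro open_Collect_less continuous_intros)
  then have "eventually (\<lambda>x. B < \<bar>x\<bar>) (nhds x)"
    using assms(2) eventually_nhds_in_open[of "{x. B < \<bar>x\<bar>}" x] by auto
  then have "eventually (\<lambda>x. f x = 0) (nhds x)"
    by (rule eventually_mono) (rule assms(1))
  then have "deriv f x = deriv (\<lambda>_. 0) x"
    by (intro deriv_cong_ev) auto
  then show ?thesis by simp
qed

text \<open>The complement of \<open>{-B..B}\<close> is open, so vanishing of \<open>f\<close> there
  passes to both derivatives with the same \<open>B\<close>. The facts obtained are exactly the
  hypotheses of the Taylor lemmas below.\<close>

lemma C0_2_compactly_supportedE:
  assumes "f \<in> C0_2" and "compactly_supported f"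
  obtains B where "0 < B"
    and "\<And>x. (f has_real_derivative deriv f x) (at x)"
    and "\<And>x. (deriv f has_real_derivative deriv (deriv f) x) (at x)"
    and "continuous_on UNIV (deriv (deriv f))"
    and "\<And>x. B < \<bar>x\<bar> \<Longrightarrow> deriv f x = 0"
    and "\<And>x. B < \<bar>x\<bar> \<Longrightarrow> deriv (deriv f) x = 0"
proof -
  have "bounded {x. f x \<noteq> 0}"
    using bounded_subset[OF compact_imp_bounded closure_subset] assms(2)
    by (simp add: compactly_supported_def)
  then obtain B where B: "0 < B" "\<And>x. f x \<noteq> 0 \<Longrightarrow> \<bar>x\<bar> \<le> B"
    by (auto simp: bounded_pos)
  have f0: "f x = 0" if "B < \<bar>x\<bar>" for x
    using B(2)[of x] that by auto
  note f1 = deriv_eq_0_outside[of B f, OF f0]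
  note f2 = deriv_eq_0_outside[of B "deriv f", OF f1]
  show ?thesis
  proof (rule that[OF B(1) _ _ _ f1 f2])
    show "(f has_real_derivative deriv f x) (at x)"
      and "(deriv f has_real_derivative deriv (deriv f) x) (at x)"
      and "continuous_on UNIV (deriv (deriv f))" for x
      using assms(1) by (auto simp: C0_2_def C0_def DERIV_deriv_iff_real_differentiable)
  qed
qed

section \<open>Taylor's formula as an integral over the whole line\<close>

text \<open>Here \<open>g\<close> is the smooth integrand and \<open>h\<close> its cut-off version,
  written with indicators or \<open>max\<close>. Nothing is asked of \<open>h\<close> at
  \<open>a\<close> and \<open>b\<close>, a null set, so open and closed cut-offs are treated
  alike.\<close>

lemma lborel_integral_FTC:
  fixes F g h :: "real \<Rightarrow> real"
  assumes "a \<le> b"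
    and "\<And>x. (F has_real_derivative g x) (at x)"
    and "continuous_on UNIV g"
    and "\<And>x. a < x \<Longrightarrow> x < b \<Longrightarrow> h x = g x"
    and "\<And>x. x < a \<or> b < x \<Longrightarrow> h x = 0"
    and "h \<in> borel_measurable borel"
  shows "has_bochner_integral lborel h (F b - F a)"
proof -
  have "has_bochner_integral lborel (\<lambda>x. g x * indicator {a..b} x) (F b - F a)"
    using assms(1-3)
    by (intro has_bochner_integral_FTC_Icc_real)
      (auto simp: continuous_on_eq_continuous_at intro: DERIV_subset)
  moreover have "AE x in lborel. h x = g x * indicator {a..b} x"
    using AE_lborel_singleton[of a] AE_lborel_singleton[of b]
    by eventually_elim (use assms(4,5) in \<open>auto simp: indicator_def not_le less_le\<close>)
  ultimately show ?thesis
    using assms(3,6)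
    by (subst has_bochner_integral_cong_AE)
      (auto intro: borel_measurable_continuous_onI)
qed

context
  fixes f f' f'' :: "real \<Rightarrow> real" and B :: real
  assumes B_pos: "0 < B"
    and deriv_f: "\<And>x. (f has_real_derivative f' x) (at x)"
    and deriv_f': "\<And>x. (f' has_real_derivative f'' x) (at x)"
    and cont_f'': "continuous_on UNIV f''"
    and f'_outside: "\<And>x. B < \<bar>x\<bar> \<Longrightarrow> f' x = 0"
    and f''_outside: "\<And>x. B < \<bar>x\<bar> \<Longrightarrow> f'' x = 0"
begin

lemma measurable_f'': "f'' \<in> borel_measurable borel"
  using cont_f'' by (rule borel_measurable_continuous_onI)

lemma cont_f''_shift: "continuous_on UNIV (\<lambda>r. f'' (x + r))"
  by (rule continuous_on_compose2[OF cont_f'']) (auto intro!: continuous_intros)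

lemma deriv_f_shift: "((\<lambda>r. f (x + r)) has_real_derivative f' (x + r)) (at r)"
  using deriv_f[of "x + r"] by (simp add: DERIV_shift add.commute)

lemma deriv_f'_shift: "((\<lambda>r. f' (x + r)) has_real_derivative f'' (x + r)) (at r)"
  using deriv_f'[of "x + r"] by (simp add: DERIV_shift add.commute)

lemma has_integral_f''_left:
  "has_bochner_integral lborel (\<lambda>r. indicator {..<0} r * f'' (x + r)) (f' x)"
proof -
  note [measurable] = measurable_f''
  \<comment> \<open>The lower limit is so far left that \<open>x + r < - B\<close> there and beyond:
    the half-line integral reduces to a bounded interval, and its lower boundary term
    vanishes.\<close>
  have "has_bochner_integral lborel (\<lambda>r. indicator {..<0} r * f'' (x + r))
      (f' (x + 0) - f' (x + - (B + \<bar>x\<bar> + 1)))"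
    using B_pos
    by (intro lborel_integral_FTC[OF _ deriv_f'_shift cont_f''_shift])
      (auto simp: indicator_def f''_outside)
  moreover have "f' (x + - (B + \<bar>x\<bar> + 1)) = 0"
    using B_pos by (intro f'_outside) auto
  ultimately show ?thesis by simp
qed

lemma has_integral_f''_right:
  "has_bochner_integral lborel (\<lambda>r. indicator {0<..} r * f'' (x + r)) (- f' x)"
proof -
  note [measurable] = measurable_f''
  have "has_bochner_integral lborel (\<lambda>r. indicator {0<..} r * f'' (x + r))
      (f' (x + (B + \<bar>x\<bar> + 1)) - f' (x + 0))"
    using B_pos
    by (intro lborel_integral_FTC[OF _ deriv_f'_shift cont_f''_shift])
      (auto simp: indicator_def f''_outside)
  moreover have "f' (x + (B + \<bar>x\<bar> + 1)) = 0"
    using B_pos by (intro f'_outside) auto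
  ultimately show ?thesis by simp
qed

text \<open>Integration by parts in antiderivative form: the two terms with \<open>f'\<close>
  cancel. The antiderivative is \<open>f (x + y)\<close> at \<open>r = y\<close> and
  \<open>y * f' x + f x\<close> at \<open>r = 0\<close>.\<close>

lemma taylor_deriv:
  "((\<lambda>r. (y - r) * f' (x + r) + f (x + r)) has_real_derivative (y - r) * f'' (x + r)) (at r)"
  by (rule derivative_eq_intros deriv_f_shift deriv_f'_shift refl | simp)+

lemma taylor_right:
  assumes "0 < y"
  shows "has_bochner_integral lborel (\<lambda>r. indicator {0<..} r * max (y - r) 0 * f'' (x + r))
           (f (x + y) - f x - y * f' x)"
proof -
  note [measurable] = measurable_f''
  have "has_bochner_integral lborel (\<lambda>r. indicator {0<..} r * max (y - r) 0 * f'' (x + r))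
      (((y - y) * f' (x + y) + f (x + y)) - ((y - 0) * f' (x + 0) + f (x + 0)))"
    using assms
    by (intro lborel_integral_FTC[OF _ taylor_deriv] continuous_intros cont_f''_shift)
      (auto simp: indicator_def)
  then show ?thesis by (simp add: algebra_simps)
qed

lemma taylor_left:
  assumes "y < 0"
  shows "has_bochner_integral lborel (\<lambda>r. indicator {..<0} r * max (r - y) 0 * f'' (x + r))
           (f (x + y) - f x - y * f' x)"
proof -
  note [measurable] = measurable_f''
  \<comment> \<open>For \<open>y < r < 0\<close> the negated integrand is
    \<open>(y - r) * f'' (x + r)\<close>, so the same antiderivative applies. Integrating upwards
    from \<open>y\<close> to \<open>0\<close> gives the negated increment, and a final change of
    sign removes both minus signs.\<close>
  have "has_bochner_integral lborel (\<lambda>r. - (indicator {..<0} r * max (r - y) 0 * f'' (x + r)))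
      (((y - 0) * f' (x + 0) + f (x + 0)) - ((y - y) * f' (x + y) + f (x + y)))"
    using assms
    by (intro lborel_integral_FTC[OF _ taylor_deriv] continuous_intros cont_f''_shift)
      (auto simp: indicator_def algebra_simps)
  from has_bochner_integral_minus[OF this] show ?thesis by (simp add: algebra_simps)
qed

end

section \<open>The kernel representing a compensated increment\<close>

text \<open>
  For $|y| \le 1$ this is the Taylor remainder kernel; for $|y| > 1$ the term $y f'(x)$ is not
  compensated, and expressing it through $f''$ on the half-axis containing $y$ contributes $-|y|$.
\<close>

definition increment_kernel :: "real \<Rightarrow> real \<Rightarrow> real" where
  "increment_kernel y r =
     (if 0 < y * r then max (\<bar>y\<bar> - \<bar>r\<bar>) 0 - (if 1 < \<bar>y\<bar> then \<bar>y\<bar> else 0) else 0)"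

lemma measurable_increment_kernel [measurable]:
  "case_prod increment_kernel \<in> borel_measurable (borel \<Otimes>\<^sub>M borel)"
  unfolding increment_kernel_def by measurable

text \<open>If \<open>1 < |y|\<close> and \<open>r\<close> lies on the side of \<open>y\<close>, the
  kernel equals \<open>- min |r| |y|\<close>, which is bounded by \<open>R\<close> uniformly in
  \<open>y\<close>. For small \<open>y\<close> both its height and its support are of size
  \<open>|y|\<close>.\<close>

lemma increment_kernel_bound:
  assumes "\<bar>r\<bar> \<le> R"
  shows "\<bar>increment_kernel y r\<bar>
           \<le> (if 1 < \<bar>y\<bar> then R * indicator {-R..R} r else \<bar>y\<bar> * indicator {-\<bar>y\<bar>..\<bar>y\<bar>} r)"
  using assms by (auto simp: increment_kernel_def indicator_def max_def)

lemma integral_increment_kernel: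
  fixes f f' f'' :: "real \<Rightarrow> real"
  assumes "0 < B"
    and "\<And>x. (f has_real_derivative f' x) (at x)"
    and "\<And>x. (f' has_real_derivative f'' x) (at x)"
    and "continuous_on UNIV f''"
    and "\<And>x. B < \<bar>x\<bar> \<Longrightarrow> f' x = 0"
    and "\<And>x. B < \<bar>x\<bar> \<Longrightarrow> f'' x = 0"
  shows "(LINT r|lborel. increment_kernel y r * f'' (x + r))
           = f (x + y) - f x - y * f' x * indicator {-1..1} y"
proof -
  \<comment> \<open>Subtracting \<open>c\<close> times the integral of \<open>f''\<close> over the
    half-axis containing \<open>y\<close> adds \<open>y * f' x\<close> exactly when
    \<open>1 < |y|\<close>; this cancels the Taylor compensator outside
    \<open>{-1..1}\<close>.\<close>
  define c where "c = (if 1 < \<bar>y\<bar> then \<bar>y\<bar> else 0)"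
  consider "y = 0" | "0 < y" | "y < 0" by linarith
  then show ?thesis
  proof cases
    case 1
    then show ?thesis by (simp add: increment_kernel_def)
  next
    case 2
    have "has_bochner_integral lborel
        (\<lambda>r. indicator {0<..} r * max (y - r) 0 * f'' (x + r) - c * (indicator {0<..} r * f'' (x + r)))
        ((f (x + y) - f x - y * f' x) - c * (- f' x))"
      by (intro has_bochner_integral_diff has_bochner_integral_mult_right
          taylor_right[OF assms] has_integral_f''_right[OF assms] 2)
    moreover have "(\<lambda>r. indicator {0<..} r * max (y - r) 0 * f'' (x + r)
          - c * (indicator {0<..} r * f'' (x + r)))
        = (\<lambda>r. increment_kernel y r * f'' (x + r))"
      using 2 by (auto simp: fun_eq_iff increment_kernel_def c_def indicator_def
          zero_less_mult_iff algebra_simps)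
    ultimately show ?thesis
      using 2 by (auto simp: has_bochner_integral_iff c_def indicator_def)
  next
    case 3
    have "has_bochner_integral lborel
        (\<lambda>r. indicator {..<0} r * max (r - y) 0 * f'' (x + r) - c * (indicator {..<0} r * f'' (x + r)))
        ((f (x + y) - f x - y * f' x) - c * f' x)"
      by (intro has_bochner_integral_diff has_bochner_integral_mult_right
          taylor_left[OF assms] has_integral_f''_left[OF assms] 3)
    moreover have "(\<lambda>r. indicator {..<0} r * max (r - y) 0 * f'' (x + r)
          - c * (indicator {..<0} r * f'' (x + r)))
        = (\<lambda>r. increment_kernel y r * f'' (x + r))"
      using 3 by (auto simp: fun_eq_iff increment_kernel_def c_def indicator_def
          zero_less_mult_iff algebra_simps)
    ultimately show ?thesis
      using 3 by (auto simp: has_bochner_integral_iff c_def indicator_def)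
  qed
qed

section \<open>Integrability against a Levy measure\<close>

lemma integrable_levy_weight:
  assumes "levy_measure N"
  shows "integrable N (\<lambda>y. y\<^sup>2 / (1 + y\<^sup>2))"
proof -
  have [measurable_cong]: "sets N = sets borel"
    using assms by (simp add: levy_measure_def)
  show ?thesis
  proof (rule integrableI_nonneg)
    show "(\<lambda>y. y\<^sup>2 / (1 + y\<^sup>2)) \<in> borel_measurable N"
      by measurable
  qed (use assms in \<open>auto simp: levy_measure_def\<close>)
qed

text \<open>By Markov's inequality the superlevel sets of the weight
  \<open>y\<^sup>2 / (1 + y\<^sup>2)\<close> have finite measure. They exhaust everything except
  \<open>0\<close>, where the weight vanishes, and \<open>{0}\<close> is a null set. Fubini's
  theorem relies on this.\<close>

lemma sigma_finite_levy_measure: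
  assumes "levy_measure N"
  shows "sigma_finite_measure N"
proof -
  have sets_N [measurable_cong]: "sets N = sets borel"
    using assms by (simp add: levy_measure_def)
  define w :: "real \<Rightarrow> real" where "w = (\<lambda>y. y\<^sup>2 / (1 + y\<^sup>2))"
  define S where "S = (\<lambda>n::nat. {y. 1 / real (Suc n) \<le> w y})"
  have w_int: "integrable N w"
    unfolding w_def using assms by (rule integrable_levy_weight)
  have w_meas [measurable]: "w \<in> borel_measurable borel"
    unfolding w_def by measurable
  have space_N: "space N = UNIV"
    using sets_eq_imp_space_eq[OF sets_N] by simp
  have S_sets: "S n \<in> sets N" for n
    unfolding sets_N S_def by measurable
  have S_fin: "emeasure N (S n) \<noteq> \<infinity>" for n
  proof -
    have "emeasure N {y \<in> space N. 1 / real (Suc n) \<le> w y}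
        \<le> ennreal (1 / (1 / real (Suc n)) * (LINT y|N. w y))"
      by (intro integral_Markov_inequality w_int) (auto simp: w_def)
    then show ?thesis by (auto simp: S_def space_N top_unique)
  qed
  have cover: "\<exists>n. y \<in> S n" if "y \<noteq> 0" for y
  proof -
    have "0 < w y"
      using that by (auto simp: w_def add_pos_nonneg)
    then obtain n where "1 / real (Suc n) < w y"
      using nat_approx_posE by blast
    then have "y \<in> S n" by (simp add: S_def)
    then show ?thesis ..
  qed
  have cover': "insert 0 (\<Union>n. S n) = UNIV"
    using cover by blast
  show ?thesis
  proof
    show "\<exists>C. countable C \<and> C \<subseteq> sets N \<and> \<Union>C = space N \<and> (\<forall>a\<in>C. emeasure N a \<noteq> \<infinity>)"
      using S_fin S_sets assms cover'
      by (intro exI[of _ "insert {0} (range S)"])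
        (auto simp: space_N sets_N levy_measure_def)
  qed
qed

text \<open>The hypothesis on the support confines $r$ to a bounded set, as $\kappa(y,\cdot)$ does not decay.\<close>

lemma integrable_increment_kernel:
  fixes \<phi> :: "real \<Rightarrow> real"
  assumes "levy_measure N"
    and [measurable]: "\<phi> \<in> borel_measurable borel"
    and bound: "\<And>r. \<bar>\<phi> r\<bar> \<le> C * indicator {-R..R} r" and "0 \<le> C" and "0 \<le> R"
  shows "integrable (N \<Otimes>\<^sub>M lborel) (\<lambda>(y, r). increment_kernel y r * \<phi> r)"
proof -
  have [measurable_cong]: "sets N = sets borel"
    using assms by (simp add: levy_measure_def)
  interpret N: sigma_finite_measure N
    using assms(1) by (rule sigma_finite_levy_measure)
  interpret pair_sigma_finite N lborel ..
  \<comment> \<open>The inner integral will be at most \<open>2 * C * a\<^sup>2\<close>, with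
    \<open>a\<close> as below. For \<open>1 < |y|\<close> the estimate
    \<open>1 + y\<^sup>2 \<le> 2 * y\<^sup>2\<close> costs \<open>4 * R\<^sup>2\<close>; for
    \<open>|y| \<le> 1\<close> the estimate \<open>1 + y\<^sup>2 \<le> 2\<close> costs
    \<open>4\<close>. The sum covers both cases.\<close>
  define K where "K = C * (4 + 4 * R\<^sup>2)"
  have "(\<integral>\<^sup>+r. ennreal (norm (increment_kernel y r * \<phi> r)) \<partial>lborel) \<le> ennreal (K * (y\<^sup>2 / (1 + y\<^sup>2)))"
    for y
  proof -
    \<comment> \<open>On \<open>|r| \<le> R\<close>, \<open>a\<close> bounds both the height of the
      kernel and the half-width of its support. Hence the inner integral is quadratic in
      \<open>y\<close> near \<open>0\<close>, matching the Levy weight.\<close>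
    define a :: real where "a = (if 1 < \<bar>y\<bar> then R else \<bar>y\<bar>)"
    have a: "0 \<le> a" using \<open>0 \<le> R\<close> by (auto simp: a_def)
    have "norm (increment_kernel y r * \<phi> r) \<le> C * a * indicator {-a..a} r" for r
    proof (cases "\<bar>r\<bar> \<le> R")
      case True
      have "\<bar>increment_kernel y r\<bar> \<le> a * indicator {-a..a} r"
        using increment_kernel_bound[OF True, of y] by (auto simp: a_def)
      moreover have "\<bar>\<phi> r\<bar> \<le> C"
        using bound[of r] True by (simp add: indicator_def abs_le_iff)
      ultimately have "\<bar>increment_kernel y r\<bar> * \<bar>\<phi> r\<bar> \<le> (a * indicator {-a..a} r) * C"
        using a by (intro mult_mono) auto
      then show ?thesis by (simp add: abs_mult mult_ac)
    next
      case False
      then have "r \<notin> {-R..R}" by auto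
      then have "\<phi> r = 0" using bound[of r] by simp
      then show ?thesis using a \<open>0 \<le> C\<close> by auto
    qed
    then have "(\<integral>\<^sup>+r. ennreal (norm (increment_kernel y r * \<phi> r)) \<partial>lborel)
        \<le> (\<integral>\<^sup>+r. ennreal (C * a * indicator {-a..a} r) \<partial>lborel)"
      by (intro nn_integral_mono ennreal_leI)
    also have "\<dots> = (\<integral>\<^sup>+r. ennreal (C * a) * indicator {-a..a} r \<partial>lborel)"
      by (intro nn_integral_cong) (auto simp: indicator_def)
    also have "\<dots> = ennreal (C * a) * ennreal (2 * a)"
      using a by (simp add: nn_integral_cmult_indicator)
    also have "\<dots> = ennreal (C * (2 * a\<^sup>2))"
      using a \<open>0 \<le> C\<close> by (simp add: ennreal_mult[symmetric] power2_eq_square mult_ac)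
    also have "\<dots> \<le> ennreal (K * (y\<^sup>2 / (1 + y\<^sup>2)))"
    proof (rule ennreal_leI)
      have pos: "0 < 1 + y\<^sup>2" by (simp add: add_pos_nonneg)
      have "2 * a\<^sup>2 * (1 + y\<^sup>2) \<le> (4 + 4 * R\<^sup>2) * y\<^sup>2"
      proof (cases "1 < \<bar>y\<bar>")
        case True
        then have "1 \<le> y\<^sup>2" using abs_le_square_iff[of 1 y] by simp
        then have "2 * R\<^sup>2 * (1 + y\<^sup>2) \<le> 2 * R\<^sup>2 * (2 * y\<^sup>2)"
          by (intro mult_left_mono) auto
        moreover have "0 \<le> 4 * y\<^sup>2" by simp
        ultimately have "2 * R\<^sup>2 * (1 + y\<^sup>2) \<le> 2 * R\<^sup>2 * (2 * y\<^sup>2) + 4 * y\<^sup>2" by linarith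
        then show ?thesis using True by (simp add: a_def algebra_simps)
      next
        case False
        then have "y\<^sup>2 \<le> 1" using abs_le_square_iff[of y 1] by simp
        then have "2 * y\<^sup>2 * (1 + y\<^sup>2) \<le> 2 * y\<^sup>2 * 2"
          by (intro mult_left_mono) auto
        moreover have "0 \<le> 4 * R\<^sup>2 * y\<^sup>2" by simp
        ultimately have "2 * y\<^sup>2 * (1 + y\<^sup>2) \<le> 2 * y\<^sup>2 * 2 + 4 * R\<^sup>2 * y\<^sup>2" by linarith
        then show ?thesis using False by (simp add: a_def algebra_simps)
      qed
      then have "2 * a\<^sup>2 \<le> (4 + 4 * R\<^sup>2) * (y\<^sup>2 / (1 + y\<^sup>2))"
        using pos by (simp add: field_simps)
      then show "C * (2 * a\<^sup>2) \<le> K * (y\<^sup>2 / (1 + y\<^sup>2))"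
        unfolding K_def mult.assoc using \<open>0 \<le> C\<close> by (intro mult_left_mono)
    qed
    finally show ?thesis .
  qed
  then have "(\<integral>\<^sup>+y. (\<integral>\<^sup>+r. ennreal (norm (increment_kernel y r * \<phi> r)) \<partial>lborel) \<partial>N)
      \<le> (\<integral>\<^sup>+y. ennreal (K * (y\<^sup>2 / (1 + y\<^sup>2))) \<partial>N)"
    by (intro nn_integral_mono) auto
  also have "\<dots> < \<infinity>"
  proof -
    have "integrable N (\<lambda>y. K * (y\<^sup>2 / (1 + y\<^sup>2)))"
      by (intro integrable_mult_right integrable_levy_weight assms)
    then show ?thesis
      using \<open>0 \<le> C\<close> by (subst nn_integral_eq_integral) (auto simp: K_def)
  qed
  finally have "(\<integral>\<^sup>+p. ennreal (norm (case p of (y, r) \<Rightarrow> increment_kernel y r * \<phi> r))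
      \<partial>(N \<Otimes>\<^sub>M lborel)) < \<infinity>"
    by (subst lborel.nn_integral_fst[symmetric]) auto
  then show ?thesis
    by (intro integrableI_bounded) auto
qed

section \<open>The convolution kernel and its local integrability\<close>

text \<open>The indicator turns the drift into an integral of the second derivative, by
  \<open>has_integral_f''_left\<close>. On each open half-axis the kernel is a primitive of the
  signed tail of \<open>N\<close>: the mass to the left of \<open>r\<close> for
  \<open>r < 0\<close>, minus the mass to the right of \<open>r\<close> for
  \<open>0 < r\<close>.\<close>

definition convolution_kernel :: "real \<Rightarrow> real measure \<Rightarrow> real \<Rightarrow> real" where
  "convolution_kernel \<gamma> N r = \<gamma> * indicator {..<0} r + (LINT y|N. increment_kernel y r)"

lemma locally_integrable_convolution_kernel:
  assumes "levy_measure N" and "0 < R"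
  shows "set_integrable lborel {-R..R} (convolution_kernel \<gamma> N)"
proof -
  interpret N: sigma_finite_measure N
    using assms(1) by (rule sigma_finite_levy_measure)
  interpret pair_sigma_finite N lborel ..
  \<comment> \<open>The test function is the indicator of \<open>{-R..R}\<close>; Fubini then makes
    the marginal in \<open>r\<close> integrable.\<close>
  have "integrable (N \<Otimes>\<^sub>M lborel) (\<lambda>(y, r). increment_kernel y r * indicator {-R..R} r)"
    using assms by (intro integrable_increment_kernel[where C = 1 and R = R]) (auto simp: indicator_def)
  then have "integrable lborel (\<lambda>r. LINT y|N. increment_kernel y r * indicator {-R..R} r)"
    by (rule integrable_snd)
  moreover have "integrable lborel (\<lambda>r. \<gamma> * indicator ({..<0} \<inter> {-R..R}) r :: real)"
    using emeasure_mono[of "{..<0} \<inter> {-R..R}" "{-R..R}" lborel]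
    by (intro integrable_mult_right integrable_real_indicator)
      (auto simp: emeasure_lborel_Icc_eq less_top[symmetric] top_unique)
  ultimately have "integrable lborel (\<lambda>r. \<gamma> * indicator ({..<0} \<inter> {-R..R}) r
      + (LINT y|N. increment_kernel y r * indicator {-R..R} r))"
    by (rule Bochner_Integration.integrable_add[rotated])
  then show ?thesis
    unfolding set_integrable_def convolution_kernel_def
    by (rule back_subst[where P = "integrable lborel"])
      (auto simp: fun_eq_iff indicator_inter_arith algebra_simps)
qed

section \<open>Differentiating a convolution\<close>

text \<open>Since \<open>k\<close> is only locally integrable, the derivative must fall on
  \<open>g\<close>. After the translation \<open>y = x + r\<close> the variable \<open>x\<close>
  occurs in \<open>g\<close> alone, and the difference quotients are dominated by
  \<open>C * |k|\<close> on a bounded set.\<close>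

lemma has_derivative_convolution:
  fixes k g g' :: "real \<Rightarrow> real"
  assumes k: "\<And>R. 0 < R \<Longrightarrow> set_integrable lborel {-R..R} k"
    and g: "\<And>x. (g has_real_derivative g' x) (at x)"
    and g': "continuous_on UNIV g'"
    and g0: "\<And>x. B < \<bar>x\<bar> \<Longrightarrow> g x = 0"
    and g'_bound: "\<And>x. \<bar>g' x\<bar> \<le> C" and "0 < B"
  shows "((\<lambda>x. LINT y|lborel. k (y - x) * g y) has_real_derivative
            (LINT r|lborel. k r * g' (x + r))) (at x)"
proof -
  have shift: "(LINT y|lborel. k (y - x) * g y) = (LINT r|lborel. k r * g (x + r))" for x
    using lborel_integral_real_affine[of 1 "\<lambda>y. k (y - x) * g y" x] by simp
  have [measurable]: "g \<in> borel_measurable borel"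
    using g by (intro borel_measurable_continuous_onI) (meson DERIV_isCont continuous_at_imp_continuous_on)
  have [measurable]: "g' \<in> borel_measurable borel"
    using g' by (rule borel_measurable_continuous_onI)
  have C: "0 \<le> C" using g'_bound[of 0] by linarith
  have lip: "\<bar>g u - g v\<bar> \<le> C * \<bar>u - v\<bar>" for u v
    using field_differentiable_bound[of UNIV g g' C u v] g g'_bound by simp
  \<comment> \<open>The margin \<open>1\<close> makes \<open>{-R x..R x}\<close> contain every
    \<open>r\<close> with \<open>|x + h + r| \<le> B\<close> for all \<open>|h| \<le> 1\<close>, so
    one cut-off of \<open>k\<close> serves all these shifts.\<close>
  define R where "R = (\<lambda>x. B + \<bar>x\<bar> + 1)"
  have R: "0 < R x" for x using \<open>0 < B\<close> by (simp add: R_def)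
  have k_meas: "(\<lambda>r. indicator {-R x..R x} r * k r) \<in> borel_measurable borel" for x
    using k[OF R[of x]] by (simp add: set_integrable_def)
  have cut: "k r * g (x + h + r) = (indicator {-R x..R x} r * k r) * g (x + h + r)"
    if "\<bar>h\<bar> \<le> 1" for r h x
  proof (cases "B < \<bar>x + h + r\<bar>")
    case False
    then have "\<bar>r\<bar> \<le> R x" using that by (auto simp: R_def)
    then show ?thesis by (auto simp: indicator_def abs_le_iff)
  qed (simp add: g0)
  \<comment> \<open>\<open>g\<close> vanishes at \<open>B + 1\<close>, so the Lipschitz bound
    measured from that point controls \<open>g\<close> on its support.\<close>
  have g_bound: "\<bar>g u\<bar> \<le> C * (2 * B + 2)" for u
  proof (cases "\<bar>u\<bar> \<le> B")
    case True
    have "\<bar>g u - g (B + 1)\<bar> \<le> C * \<bar>u - (B + 1)\<bar>" by (rule lip)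
    also have "\<dots> \<le> C * (2 * B + 2)" using True C by (intro mult_left_mono) auto
    finally show ?thesis using g0[of "B + 1"] \<open>0 < B\<close> by simp
  next
    case False
    then show ?thesis using g0[of u] C \<open>0 < B\<close> by simp
  qed
  have int: "integrable lborel (\<lambda>r. k r * g (x + h + r))" if "\<bar>h\<bar> \<le> 1" for h x
  proof (rule Bochner_Integration.integrable_bound)
    show "integrable lborel (\<lambda>r. (C * (2 * B + 2)) * (indicator {-R x..R x} r * k r))"
      using k[OF R[of x]] by (intro integrable_mult_right) (simp add: set_integrable_def)
    show "(\<lambda>r. k r * g (x + h + r)) \<in> borel_measurable lborel"
      unfolding cut[OF that] using k_meas[of x] by measurable
    show "AE r in lborel. norm (k r * g (x + h + r))
        \<le> norm (C * (2 * B + 2) * (indicator {-R x..R x} r * k r))"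
      unfolding cut[OF that] using g_bound C \<open>0 < B\<close>
      by (intro AE_I2) (auto simp: abs_mult mult.commute intro!: mult_right_mono)
  qed
  \<comment> \<open>The limit is taken along sequences so that dominated convergence
    applies.\<close>
  show ?thesis
    unfolding shift DERIV_def tendsto_at_iff_sequentially
  proof (intro allI impI)
    fix s :: "nat \<Rightarrow> real"
    assume s: "\<forall>i. s i \<in> UNIV - {0}" "s \<longlonglongrightarrow> 0"
    have small: "eventually (\<lambda>i. \<bar>s i\<bar> \<le> 1) sequentially"
      using tendstoD[OF s(2), of 1] by (auto elim: eventually_mono)
    \<comment> \<open>The value \<open>0\<close> for \<open>|s i| > 1\<close> makes the domination
      hold for every \<open>i\<close>; since \<open>s\<close> tends to \<open>0\<close>, this
      changes only finitely many terms.\<close>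
    define q where "q = (\<lambda>i r. (if \<bar>s i\<bar> \<le> 1 then k r * ((g (x + s i + r) - g (x + r)) / s i) else 0))"
    have q_cut: "q i r = (if \<bar>s i\<bar> \<le> 1 then
        (indicator {-R x..R x} r * k r) * ((g (x + s i + r) - g (x + r)) / s i) else 0)" for i r
    proof (cases "\<bar>s i\<bar> \<le> 1")
      case True
      have "k r * ((g (x + s i + r) - g (x + r)) / s i)
          = (k r * g (x + s i + r) - k r * g (x + 0 + r)) / s i"
        by (simp add: right_diff_distrib)
      also have "\<dots> = (indicator {-R x..R x} r * k r * g (x + s i + r)
          - indicator {-R x..R x} r * k r * g (x + 0 + r)) / s i"
        by (intro arg_cong2[where f = "(/)"] arg_cong2[where f = "(-)"] cut refl) (use True in auto)
      finally show ?thesis using True by (simp add: q_def right_diff_distrib)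
    qed (simp add: q_def)
    have lim: "(\<lambda>i. q i r) \<longlonglongrightarrow> k r * g' (x + r)" for r
    proof -
      have "((\<lambda>h. (g (x + r + h) - g (x + r)) / h) \<circ> s) \<longlonglongrightarrow> g' (x + r)"
        using g[of "x + r"] s unfolding DERIV_def tendsto_at_iff_sequentially by blast
      then have "(\<lambda>i. k r * ((g (x + s i + r) - g (x + r)) / s i)) \<longlonglongrightarrow> k r * g' (x + r)"
        by (intro tendsto_mult_left) (simp add: o_def add_ac)
      then show ?thesis
        by (rule Lim_transform_eventually) (use small in \<open>auto elim: eventually_mono simp: q_def\<close>)
    qed
    have q_meas: "q i \<in> borel_measurable lborel" for i
      unfolding q_cut[abs_def] using k_meas[of x] by measurable
    have "(\<lambda>i. integral\<^sup>L lborel (q i)) \<longlonglongrightarrow> (LINT r|lborel. k r * g' (x + r))"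
    proof (rule integral_dominated_convergence)
      show "(\<lambda>r. k r * g' (x + r)) \<in> borel_measurable lborel"
        by (rule borel_measurable_LIMSEQ_metric[of q, OF q_meas]) (rule lim)
      show "integrable lborel (\<lambda>r. C * norm (indicator {-R x..R x} r * k r))"
        using k[OF R[of x]]
        by (intro integrable_mult_right integrable_norm) (simp add: set_integrable_def)
      show "AE r in lborel. norm (q i r) \<le> C * norm (indicator {-R x..R x} r * k r)" for i
      proof (rule AE_I2)
        fix r
        have "\<bar>(g (x + s i + r) - g (x + r)) / s i\<bar> \<le> C"
          using lip[of "x + s i + r" "x + r"] s(1) by (simp add: divide_le_eq abs_divide)
        then have "norm (indicator {-R x..R x} r * k r) * \<bar>(g (x + s i + r) - g (x + r)) / s i\<bar>
            \<le> norm (indicator {-R x..R x} r * k r) * C"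
          by (intro mult_left_mono) auto
        then show "norm (q i r) \<le> C * norm (indicator {-R x..R x} r * k r)"
          using C by (auto simp: q_cut abs_mult mult_ac)
      qed
    qed (use lim q_meas in auto)
    moreover have "eventually (\<lambda>i. integral\<^sup>L lborel (q i) =
        ((\<lambda>h. ((LINT r|lborel. k r * g (x + h + r)) - (LINT r|lborel. k r * g (x + r))) / h) \<circ> s) i) sequentially"
      using small
    proof eventually_elim
      case (elim i)
      have "integral\<^sup>L lborel (q i)
          = (LINT r|lborel. (k r * g (x + s i + r) - k r * g (x + 0 + r)) / s i)"
        using elim by (intro Bochner_Integration.integral_cong) (auto simp: q_def algebra_simps)
      also have "\<dots> = ((LINT r|lborel. k r * g (x + s i + r)) - (LINT r|lborel. k r * g (x + 0 + r))) / s i"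
        using int[OF elim, of x] int[of 0 x] by (simp add: Bochner_Integration.integral_diff)
      finally show ?case by simp
    qed
    ultimately show "((\<lambda>h. ((LINT r|lborel. k r * g (x + h + r)) - (LINT r|lborel. k r * g (x + r))) / h) \<circ> s)
        \<longlonglongrightarrow> (LINT r|lborel. k r * g' (x + r))"
      by (rule Lim_transform_eventually)
  qed
qed

section \<open>The generator in convolution form\<close>

lemma levy_generator_eq_convolution:
  fixes f :: "real \<Rightarrow> real"
  assumes N: "levy_measure N"
    and f: "0 < B" "\<And>x. (f has_real_derivative deriv f x) (at x)"
      "\<And>x. (deriv f has_real_derivative deriv (deriv f) x) (at x)"
      "continuous_on UNIV (deriv (deriv f))"
      "\<And>x. B < \<bar>x\<bar> \<Longrightarrow> deriv f x = 0"
      "\<And>x. B < \<bar>x\<bar> \<Longrightarrow> deriv (deriv f) x = 0"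
    and bound: "\<And>x. \<bar>deriv (deriv f) x\<bar> \<le> C"
  shows "levy_generator A \<gamma> N f x = A / 2 * deriv (deriv f) x
           + (LINT r|lborel. convolution_kernel \<gamma> N r * deriv (deriv f) (x + r))"
proof -
  interpret N: sigma_finite_measure N
    using N by (rule sigma_finite_levy_measure)
  interpret pair_sigma_finite N lborel ..
  define \<phi> where "\<phi> r = deriv (deriv f) (x + r)" for r
  have \<phi>_int: "integrable (N \<Otimes>\<^sub>M lborel) (\<lambda>(y, r). increment_kernel y r * \<phi> r)"
  \<comment> \<open>If \<open>|r| > B + |x|\<close> then \<open>|x + r| > B\<close>, so \<phi>
    vanishes there.\<close>
  proof (rule integrable_increment_kernel[where C = C and R = "B + \<bar>x\<bar>"])
    show "\<phi> \<in> borel_measurable borel"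
      unfolding \<phi>_def
      by (rule borel_measurable_continuous_onI[OF continuous_on_compose2[OF f(4)]])
        (auto intro!: continuous_intros)
    show "\<bar>\<phi> r\<bar> \<le> C * indicator {-(B + \<bar>x\<bar>)..B + \<bar>x\<bar>} r" for r
      using bound[of "x + r"] f(6)[of "x + r"] by (auto simp: \<phi>_def indicator_def)
    show "0 \<le> C" using bound[of 0] by linarith
  qed (use N f(1) in auto)
  have left: "has_bochner_integral lborel (\<lambda>r. indicator {..<0} r * \<phi> r) (deriv f x)"
    unfolding \<phi>_def by (rule has_integral_f''_left[OF f])
  have "(LINT y|N. f (x + y) - f x - y * deriv f x * indicator {-1..1} y)
      = (LINT y|N. LINT r|lborel. increment_kernel y r * \<phi> r)"
    unfolding \<phi>_def by (simp add: integral_increment_kernel[OF f])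
  also have "\<dots> = (LINT r|lborel. LINT y|N. increment_kernel y r * \<phi> r)"
    using Fubini_integral[OF \<phi>_int] by simp
  finally have "\<gamma> * deriv f x + (LINT y|N. f (x + y) - f x - y * deriv f x * indicator {-1..1} y)
      = (LINT r|lborel. \<gamma> * (indicator {..<0} r * \<phi> r))
        + (LINT r|lborel. LINT y|N. increment_kernel y r * \<phi> r)"
    using left by (simp add: has_bochner_integral_iff)
  also have "\<dots> = (LINT r|lborel. \<gamma> * (indicator {..<0} r * \<phi> r)
        + (LINT y|N. increment_kernel y r * \<phi> r))"
    using left integrable_snd[OF \<phi>_int]
    by (intro Bochner_Integration.integral_add[symmetric] integrable_mult_right)
      (simp_all add: has_bochner_integral_iff)
  \<comment> \<open>\<open>\<phi> r\<close> is constant in \<open>y\<close> and leaves the inner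
    integral; what multiplies it is the kernel.\<close>
  also have "\<dots> = (LINT r|lborel. convolution_kernel \<gamma> N r * \<phi> r)"
    by (simp add: convolution_kernel_def algebra_simps)
  finally show ?thesis
    by (simp add: levy_generator_def \<phi>_def)
qed

theorem theorem2p1:
  fixes M :: "'a measure" and X :: "real \<Rightarrow> 'a \<Rightarrow> real"
    and A \<gamma> :: real and N :: "real measure" and \<nu> \<nu>' :: "real \<Rightarrow> real"
  assumes "levy_process M X"
    and "has_characteristics M X A \<gamma> N"
    and "stieltjes_off_0 \<nu> N"
    and "mono_on {..<0} \<nu>" and "mono_on {0<..} \<nu>"
    and "\<And>x. x \<noteq> 0 \<Longrightarrow> (\<nu> has_real_derivative \<nu>' x) (at x)"
    and "(\<integral>\<^sup>+x. ennreal (x\<^sup>2 / (1 + x\<^sup>2)) \<partial>N) = (\<integral>\<^sup>+x. ennreal (x\<^sup>2 / (1 + x\<^sup>2) * \<nu>' x) \<partial>lborel)"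
    and "(\<integral>\<^sup>+x. ennreal (x\<^sup>2 / (1 + x\<^sup>2) * \<nu>' x) \<partial>lborel) < \<infinity>"
    and "(\<nu> \<longlongrightarrow> 0) at_top" and "(\<nu> \<longlongrightarrow> 0) at_bot"
    and "((\<forall>R>0. set_integrable lborel {-R..R} \<nu> \<and>
                 set_integrable lborel {-R..R} (\<lambda>x. \<bar>x\<bar> * \<nu>' x)) \<and>
          ((\<lambda>x. x * \<nu> x) \<longlongrightarrow> 0) (at 0))
       \<or> (\<exists>k\<^sub>1 :: real \<Rightarrow> real.
            (\<forall>x. x \<noteq> 0 \<longrightarrow> (k\<^sub>1 has_real_derivative \<nu> x) (at x)) \<and>
            (\<forall>R>0. set_integrable lborel {-R..R} k\<^sub>1 \<and>
                   set_integrable lborel {-R..R} (\<lambda>x. x * \<nu> x)) \<and>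
            ((\<lambda>x. x * k\<^sub>1 x) \<longlongrightarrow> 0) (at 0) \<and>
            ((\<lambda>x. x\<^sup>2 * \<nu> x) \<longlongrightarrow> 0) (at 0))"
  shows "\<exists>k :: real \<Rightarrow> real.
           (\<forall>R>0. set_integrable lborel {-R..R} k) \<and>
           (\<forall>f \<in> C0_2. compactly_supported f \<longrightarrow>
              (\<forall>x. (convolution_operator A k (deriv f)
                      has_real_derivative levy_generator A \<gamma> N f x) (at x)))"
\<comment> \<open>The witness is built from \<gamma> and \<open>N\<close> alone, so the same kernel
  serves every \<open>f\<close>; the Gaussian coefficient stays in
  \<open>convolution_operator\<close>.\<close>
proof (intro exI[of _ "convolution_kernel \<gamma> N"] conjI allI impI ballI)
  have N: "levy_measure N"
    using assms(2) by (simp add: has_characteristics_def)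
  then show k: "set_integrable lborel {-R..R} (convolution_kernel \<gamma> N)" if "0 < R" for R
    using that by (rule locally_integrable_convolution_kernel)
  fix f x
  assume "f \<in> C0_2" and "compactly_supported f"
  then obtain B where f: "0 < B" "\<And>x. (f has_real_derivative deriv f x) (at x)"
      "\<And>x. (deriv f has_real_derivative deriv (deriv f) x) (at x)"
      "continuous_on UNIV (deriv (deriv f))"
      "\<And>x. B < \<bar>x\<bar> \<Longrightarrow> deriv f x = 0"
      "\<And>x. B < \<bar>x\<bar> \<Longrightarrow> deriv (deriv f) x = 0"
    by (rule C0_2_compactly_supportedE) blast
  have "compact (deriv (deriv f) ` {-B..B})"
    using f(4) by (intro compact_continuous_image) (auto intro: continuous_on_subset)
  then obtain C where "0 < C" and C: "\<And>x. x \<in> {-B..B} \<Longrightarrow> \<bar>deriv (deriv f) x\<bar> \<le> C"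
    using compact_imp_bounded by (force simp: bounded_pos)
  have bound: "\<bar>deriv (deriv f) x\<bar> \<le> C" for x
  proof (cases "B < \<bar>x\<bar>")
    case False
    then show ?thesis by (intro C) auto
  qed (use f(6)[of x] \<open>0 < C\<close> in auto)
  \<comment> \<open>The convolution lemma is applied with \<open>g = deriv f\<close>; the derivative
    it produces is the second-derivative form of the generator found above.\<close>
  have "((\<lambda>x. A / 2 * deriv f x + (LINT y|lborel. convolution_kernel \<gamma> N (y - x) * deriv f y))
      has_real_derivative A / 2 * deriv (deriv f) x
        + (LINT r|lborel. convolution_kernel \<gamma> N r * deriv (deriv f) (x + r))) (at x)"
    by (intro DERIV_add DERIV_cmult f(3) has_derivative_convolution[OF k f(3-5) bound f(1)])
  then show "(convolution_operator A (convolution_kernel \<gamma> N) (deriv f)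
      has_real_derivative levy_generator A \<gamma> N f x) (at x)"
    by (simp only: convolution_operator_def[abs_def] levy_generator_eq_convolution[OF N f bound])
qed

end
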